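(* For all integers $m,k\ge1$, every finite $(mk,k)$-grounded flag complex is $(m-1)$-connected.
   Context: Let $X$ be a simplicial complex and $k\ge1$. A simplex $\Delta$ of $X$ is a $k$-ground for $X$ if every vertex of $X$ is adjacent to all but at most $k$ vertices of $\Delta$. $X$ is $(n,k)$-grounded if it contains an $n$-simplex that is a $k$-ground for $X$. *)

theory Defs
  imports "HOL-Analysis.Analysis"
begin

definition simplicial_complex :: "'a set set \<Rightarrow> bool" where
  "simplicial_complex X \<longleftrightarrow>
     (\<forall>\<sigma>\<in>X. finite \<sigma> \<and> \<sigma> \<noteq> {}) \<and> (\<forall>\<sigma>\<in>X. \<forall>\<tau>. \<tau> \<subseteq> \<sigma> \<and> \<tau> \<noteq> {} \<longrightarrow> \<tau> \<in> X)"

definition vertices :: "'a set set \<Rightarrow> 'a set" where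
  "vertices X = \<Union>X"

definition adjacent :: "'a set set \<Rightarrow> 'a \<Rightarrow> 'a \<Rightarrow> bool" where
  "adjacent X u v \<longleftrightarrow> u \<noteq> v \<and> {u, v} \<in> X"

definition flag_complex :: "'a set set \<Rightarrow> bool" where
  "flag_complex X \<longleftrightarrow> simplicial_complex X \<and>
     (\<forall>\<sigma>. finite \<sigma> \<and> \<sigma> \<noteq> {} \<and> \<sigma> \<subseteq> vertices X \<and>
          (\<forall>u\<in>\<sigma>. \<forall>v\<in>\<sigma>. u \<noteq> v \<longrightarrow> adjacent X u v) \<longrightarrow> \<sigma> \<in> X)"

definition k_ground :: "'a set set \<Rightarrow> nat \<Rightarrow> 'a set \<Rightarrow> bool" where
  "k_ground X k \<Delta> \<longleftrightarrow> \<Delta> \<in> X \<and>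
     (\<forall>v\<in>vertices X. card {w\<in>\<Delta>. w \<noteq> v \<and> \<not> adjacent X v w} \<le> k)"

definition grounded :: "'a set set \<Rightarrow> nat \<Rightarrow> nat \<Rightarrow> bool" where
  "grounded X n k \<longleftrightarrow> (\<exists>\<Delta>. k_ground X k \<Delta> \<and> card \<Delta> = Suc n)"

text \<open>Geometric realization: convex combinations of vertices of a simplex, inside the
  product space of real-valued functions on the vertex type.\<close>
definition geometric_realization :: "'a set set \<Rightarrow> ('a \<Rightarrow> real) topology" where
  "geometric_realization X =
     subtopology (product_topology (\<lambda>_. euclideanreal) UNIV)
       {f. \<exists>\<sigma>\<in>X. (\<forall>x. x \<notin> \<sigma> \<longrightarrow> f x = 0) \<and> (\<forall>x\<in>\<sigma>. 0 \<le> f x) \<and> sum f \<sigma> = 1}"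

definition n_connected :: "'b topology \<Rightarrow> nat \<Rightarrow> bool" where
  "n_connected T n \<longleftrightarrow> topspace T \<noteq> {} \<and>
     (\<forall>i\<le>n. \<forall>f. continuous_map (nsphere i) T f \<longrightarrow>
        (\<exists>c. homotopic_with (\<lambda>_. True) (nsphere i) T f (\<lambda>_. c)))"

end

theory Submission
  imports Defs
begin

text \<open>
  A map of the \<open>i\<close>-sphere into the realization is first deformed inside carrier simplices to a map
  each of whose values has at most \<open>i + 1 \<le> m\<close> positive coordinates, since the sphere has covering
  dimension \<open>i\<close>. Any simplex \<open>\<sigma>\<close> with at most \<open>m\<close> vertices misses at most \<open>m k\<close> vertices of the
  ground \<open>\<Delta>\<close>, so some \<open>w \<sigma> \<in> \<Delta>\<close> is adjacent or equal to all vertices of \<open>\<sigma>\<close>. As \<open>t\<close> grows from 0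
  to 1, the coordinates of a point \<open>a\<close> are cut down to \<open>max 0 (a v - t)\<close>, while mass is put on those
  \<open>w \<sigma>\<close> for which \<open>\<sigma>\<close> contains every vertex with \<open>a v \<ge> t\<close>. By flagness the positive coordinates
  always span a simplex, and at time 1 only vertices of \<open>\<Delta>\<close> remain.
\<close>

section \<open>Realization points as normalised weights\<close>

text \<open>Allows deformations to be written as nonnegative weights whose total need not be
  1.\<close>

definition normalized :: "'a set \<Rightarrow> ('a \<Rightarrow> real) \<Rightarrow> 'a \<Rightarrow> real" where
  "normalized V a v = a v / sum a V"

lemma normalized_eq_self: "sum a V = 1 \<Longrightarrow> normalized V a = a"
  by (simp add: normalized_def fun_eq_iff)

lemma finite_simplex: "simplicial_complex X \<Longrightarrow> \<sigma> \<in> X \<Longrightarrow> finite \<sigma>"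
  and simplex_nonempty: "simplicial_complex X \<Longrightarrow> \<sigma> \<in> X \<Longrightarrow> \<sigma> \<noteq> {}"
  and face_in_complex: "simplicial_complex X \<Longrightarrow> \<sigma> \<in> X \<Longrightarrow> \<tau> \<subseteq> \<sigma> \<Longrightarrow> \<tau> \<noteq> {} \<Longrightarrow> \<tau> \<in> X"
  unfolding simplicial_complex_def by blast+

lemma finite_vertices: "simplicial_complex X \<Longrightarrow> finite X \<Longrightarrow> finite (vertices X)"
  by (auto simp: simplicial_complex_def vertices_def)

text \<open>A point determines its own carrier, namely its support, so the existential simplex of
  the definition can be replaced by a condition on \<open>a\<close> alone. Coordinates off the
  simplex vanish, so summing over all vertices changes nothing.\<close>

lemma topspace_geometric_realization:
  assumes X: "simplicial_complex X" "finite X"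
  shows "a \<in> topspace (geometric_realization X) \<longleftrightarrow>
    (\<forall>v. 0 \<le> a v) \<and> {v. a v > 0} \<in> X \<and> sum a (vertices X) = 1"
proof
  assume "a \<in> topspace (geometric_realization X)"
  then obtain \<sigma> where \<sigma>: "\<sigma> \<in> X" "\<And>x. x \<notin> \<sigma> \<Longrightarrow> a x = 0" "\<And>x. x \<in> \<sigma> \<Longrightarrow> 0 \<le> a x" "sum a \<sigma> = 1"
    by (auto simp: geometric_realization_def)
  have nonneg: "0 \<le> a v" for v
    using \<sigma>(2,3)[of v] by (cases "v \<in> \<sigma>") auto
  have sub: "{v. a v > 0} \<subseteq> \<sigma>"
    using \<sigma>(2) by force
  have "{v. a v > 0} \<noteq> {}"
  proof
    assume "{v. a v > 0} = {}"
    then have "a v = 0" for v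
      using nonneg[of v] by (metis empty_iff mem_Collect_eq order_le_less)
    with \<sigma>(4) show False
      by simp
  qed
  then have "{v. a v > 0} \<in> X"
    using sub \<sigma>(1) face_in_complex[OF X(1)] by blast
  moreover have "sum a (vertices X) = sum a \<sigma>"
    using \<sigma>(1,2) finite_vertices[OF X] by (intro sum.mono_neutral_right) (auto simp: vertices_def)
  ultimately show "(\<forall>v. 0 \<le> a v) \<and> {v. a v > 0} \<in> X \<and> sum a (vertices X) = 1"
    using nonneg \<sigma>(4) by auto
next
  assume a: "(\<forall>v. 0 \<le> a v) \<and> {v. a v > 0} \<in> X \<and> sum a (vertices X) = 1"
  define \<sigma> where "\<sigma> = {v. a v > 0}"
  have zero: "a x = 0" if "x \<notin> \<sigma>" for x
    using that a by (metis \<sigma>_def mem_Collect_eq order_le_less)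
  have "\<sigma> \<subseteq> vertices X"
    using a by (auto simp: vertices_def \<sigma>_def)
  then have "sum a (vertices X) = sum a \<sigma>"
    using zero finite_vertices[OF X] by (intro sum.mono_neutral_right) auto
  then have "\<exists>\<sigma>\<in>X. (\<forall>x. x \<notin> \<sigma> \<longrightarrow> a x = 0) \<and> (\<forall>x\<in>\<sigma>. 0 \<le> a x) \<and> sum a \<sigma> = 1"
    using a zero by (metis \<sigma>_def)
  then show "a \<in> topspace (geometric_realization X)"
    by (simp add: geometric_realization_def)
qed

lemma continuous_map_into_geometric_realization:
  "continuous_map T (geometric_realization X) F \<longleftrightarrow>
    (\<forall>v. continuous_map T euclideanreal (\<lambda>y. F y v)) \<and>
    F \<in> topspace T \<rightarrow> topspace (geometric_realization X)"
  unfolding geometric_realization_def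
  by (auto simp: continuous_map_in_subtopology continuous_map_componentwise_UNIV)

lemma normalized_in_realization:
  assumes X: "simplicial_complex X" "finite X"
    and nonneg: "\<And>v. 0 \<le> a v" and \<sigma>: "\<sigma> \<in> X" "\<And>v. a v > 0 \<Longrightarrow> v \<in> \<sigma>" and pos: "a u > 0"
  shows "sum a (vertices X) > 0"
    and "normalized (vertices X) a \<in> topspace (geometric_realization X)"
proof -
  have "u \<in> vertices X"
    using \<sigma> pos by (auto simp: vertices_def)
  then show sum: "sum a (vertices X) > 0"
    using finite_vertices[OF X] nonneg pos by (intro sum_pos2) auto
  have "{v. normalized (vertices X) a v > 0} = {v. a v > 0}"
    using sum by (auto simp: normalized_def zero_less_divide_iff)
  moreover have "{v. a v > 0} \<in> X"
    by (rule face_in_complex[OF X(1) \<sigma>(1)]) (use \<sigma>(2) pos in auto)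
  ultimately show "normalized (vertices X) a \<in> topspace (geometric_realization X)"
    using sum nonneg
    by (auto simp: topspace_geometric_realization[OF X] normalized_def simp flip: sum_divide_distrib)
qed

text \<open>The common frame for all deformations below. Division by a positive total preserves
  supports and continuity, and the realization carries the product topology, so continuity is
  checked one coordinate at a time.\<close>

lemma homotopic_normalized:
  fixes P :: "real \<times> 'b::topological_space \<Rightarrow> 'a \<Rightarrow> real"
  assumes X: "simplicial_complex X" "finite X"
    and cont: "\<And>v. continuous_on ({0..1} \<times> S) (\<lambda>y. P y v)"
    and P: "\<And>y v. y \<in> {0..1} \<times> S \<Longrightarrow> 0 \<le> P y v"
      "\<And>y. y \<in> {0..1} \<times> S \<Longrightarrow> \<exists>\<sigma>\<in>X. \<forall>v. P y v > 0 \<longrightarrow> v \<in> \<sigma>"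
      "\<And>y. y \<in> {0..1} \<times> S \<Longrightarrow> \<exists>v. P y v > 0"
  shows "homotopic_with (\<lambda>_. True) (top_of_set S) (geometric_realization X)
    (\<lambda>x. normalized (vertices X) (P (0, x))) (\<lambda>x. normalized (vertices X) (P (1, x)))"
proof -
  let ?h = "\<lambda>y. normalized (vertices X) (P y)"
  have pos: "sum (P y) (vertices X) > 0" "?h y \<in> topspace (geometric_realization X)"
    if "y \<in> {0..1} \<times> S" for y
    using normalized_in_realization[OF X] P that by metis+
  have "continuous_on ({0..1} \<times> S) (\<lambda>y. ?h y v)" for v
    unfolding normalized_def using pos(1) by (intro continuous_intros cont) fastforce
  then have "continuous_map (top_of_set ({0..1} \<times> S)) (geometric_realization X) ?h"
    using pos(2) by (auto simp: continuous_map_into_geometric_realization)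
  then show ?thesis
    unfolding homotopic_with_def
    by (intro exI[of _ ?h]) (simp add: subtopology_Times)
qed

section \<open>Hat functions of the Freudenthal triangulation\<close>

text \<open>Positive exactly on the open star of the lattice point \<open>z\<close> in the Freudenthal triangulation of
  \<open>\<real>\<^bsup>n+1\<^esup>\<close>; a point with an integer coordinate lies in at most \<open>n + 1\<close> of these open stars.\<close>
definition hat :: "nat \<Rightarrow> (nat \<Rightarrow> real) \<Rightarrow> (nat \<Rightarrow> int) \<Rightarrow> real" where
  "hat n y z = (\<Prod>j\<le>n. max 0 (1 - \<bar>y j - z j\<bar>)) *
     (\<Prod>j\<le>n. \<Prod>l\<le>n. max 0 (1 - (y j - z j) + (y l - z l)))"

lemma hat_nonneg: "0 \<le> hat n y z"
  by (auto simp: hat_def intro!: mult_nonneg_nonneg prod_nonneg)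

lemma hat_pos_iff:
  "hat n y z > 0 \<longleftrightarrow> (\<forall>j\<le>n. \<bar>y j - z j\<bar> < 1) \<and> (\<forall>j\<le>n. \<forall>l\<le>n. (y j - z j) - (y l - z l) < 1)"
proof -
  have "hat n y z > 0 \<longleftrightarrow> hat n y z \<noteq> 0"
    using hat_nonneg[of n y z] by linarith
  also have "\<dots> \<longleftrightarrow> (\<forall>j\<le>n. max 0 (1 - \<bar>y j - z j\<bar>) \<noteq> 0) \<and>
      (\<forall>j\<le>n. \<forall>l\<le>n. max 0 (1 - (y j - z j) + (y l - z l)) \<noteq> 0)"
    by (auto simp: hat_def)
  also have "\<dots> \<longleftrightarrow> (\<forall>j\<le>n. \<bar>y j - z j\<bar> < 1) \<and> (\<forall>j\<le>n. \<forall>l\<le>n. (y j - z j) - (y l - z l) < 1)"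
    by (intro arg_cong2[where f = conj] all_cong) (auto simp: max_def)
  finally show ?thesis .
qed

text \<open>Fractional parts lie in [0, 1), hence so do their absolute values, and any two differ by
  less than 1. Thus the open stars cover the whole space.\<close>

lemma hat_floor_pos: "hat n y (\<lambda>j\<in>{..n}. \<lfloor>y j\<rfloor>) > 0"
proof -
  have "0 \<le> y j - \<lfloor>y j\<rfloor>" "y j - \<lfloor>y j\<rfloor> < 1" for j
    by linarith+
  then show ?thesis
    unfolding hat_pos_iff by (smt (verit) atMost_iff restrict_apply)
qed

text \<open>If \<open>z\<close> exceeds \<open>z'\<close> at \<open>j\<close> and \<open>z'\<close>
  exceeds \<open>z\<close> at \<open>l\<close>, integrality makes the two gaps add up to at least 2,
  while adding the two difference conditions bounds the same sum strictly below 2.\<close>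

lemma hat_pos_comparable:
  assumes "hat n y z > 0" "hat n y z' > 0"
  shows "(\<forall>j\<le>n. z j \<le> z' j) \<or> (\<forall>j\<le>n. z' j \<le> z j)"
proof (rule ccontr)
  assume "\<not> ?thesis"
  then obtain j l where jl: "j \<le> n" "z' j < z j" "l \<le> n" "z l < z' l"
    by (auto simp: not_le)
  then have "real_of_int (z' j) + 1 \<le> z j" "real_of_int (z l) + 1 \<le> z' l"
    by linarith+
  moreover have "(y l - z l) - (y j - z j) < 1" "(y j - z' j) - (y l - z' l) < 1"
    using assms jl by (auto simp: hat_pos_iff)
  ultimately show False
    by linarith
qed

text \<open>The lattice points whose stars contain \<open>y\<close> form a chain, so they are told
  apart by their height above the floor of \<open>y\<close>. Each coordinate contributes 0 or 1 to
  the height and the integral coordinate \<open>j0\<close> contributes 0, which leaves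
  \<open>n + 1\<close> possible heights.\<close>

lemma card_hat_pos_le:
  assumes Z: "Z \<subseteq> PiE {..n} A" and j0: "j0 \<le> n" "y j0 \<in> \<int>"
  shows "finite {z\<in>Z. hat n y z > 0} \<and> card {z\<in>Z. hat n y z > 0} \<le> Suc n"
proof -
  let ?Z = "{z\<in>Z. hat n y z > 0}"
  define h where "h z = (\<Sum>j\<le>n. z j - \<lfloor>y j\<rfloor>)" for z :: "nat \<Rightarrow> int"
  have "inj_on h ?Z"
  proof (rule inj_onI)
    have *: "z = z'" if "z \<in> Z" "z' \<in> Z" "h z = h z'" "\<forall>j\<le>n. z j \<le> z' j" for z z'
    proof -
      have "(\<Sum>j\<le>n. z' j - z j) = 0"
        using that(3) by (simp add: h_def sum_subtractf)
      then have "\<forall>j\<in>{..n}. z' j - z j = 0"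
        using that(4) by (subst (asm) sum_nonneg_eq_0_iff) auto
      then show ?thesis
        \<comment> \<open>Membership in \<open>PiE\<close> fixes the values outside
          \<open>{..n}\<close>, so agreement on \<open>{..n}\<close> is equality.\<close>
        using Z that(1,2) by (intro PiE_ext[of z "{..n}" A z']) auto
    qed
    fix z z'
    assume "z \<in> ?Z" "z' \<in> ?Z" "h z = h z'"
    then show "z = z'"
      using hat_pos_comparable[of n y z z'] *[of z z'] *[of z' z] by auto
  qed
  moreover have "h ` ?Z \<subseteq> {0..int n}"
  proof safe
    fix z
    assume z: "hat n y z > 0"
    have bd: "0 \<le> z j - \<lfloor>y j\<rfloor> \<and> z j - \<lfloor>y j\<rfloor> \<le> 1" if "j \<le> n" for j
    proof -
      have "\<bar>y j - z j\<bar> < 1"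
        using z that by (auto simp: hat_pos_iff)
      then show ?thesis
        by linarith
    qed
    have "\<bar>y j0 - z j0\<bar> < 1"
      using z j0 by (auto simp: hat_pos_iff)
    then have zero: "z j0 - \<lfloor>y j0\<rfloor> = 0"
      using j0(2) by (auto elim!: Ints_cases)
    show "h z \<in> {0..int n}"
    proof -
      have "h z = (\<Sum>j\<in>{..n} - {j0}. z j - \<lfloor>y j\<rfloor>)"
        unfolding h_def using j0 zero by (subst sum.remove[of _ j0]) auto
      also have "\<dots> \<le> of_nat (card ({..n} - {j0})) * 1"
        using bd by (intro sum_bounded_above) auto
      finally have "h z \<le> int n"
        using j0 by simp
      then show ?thesis
        using bd by (auto simp: h_def intro!: sum_nonneg)
    qed
  qed
  ultimately show ?thesis
    using inj_on_finite[of h ?Z "{0..int n}"] card_inj_on_le[of h ?Z "{0..int n}"] by auto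
qed


section \<open>Uniform fineness on compact sets of sequences\<close>

lemma continuous_on_coordinate: "continuous_on S (\<lambda>x::nat \<Rightarrow> real. x j)"
  by (rule continuous_on_subset[OF continuous_on_product_coordinates]) simp

text \<open>The metric on functions weights the coordinates by powers of 1/2, whose total is
  2.\<close>

lemma dist_fun_nat_le:
  fixes x y :: "nat \<Rightarrow> real"
  assumes "\<And>j. \<bar>x j - y j\<bar> \<le> e"
  shows "dist x y \<le> 2 * e"
proof -
  have "(\<Sum>n. (1/2)^n * min (dist (x (from_nat n)) (y (from_nat n))) 1) \<le> (\<Sum>n. (1/2)^n * e)"
  proof (rule suminf_le)
    show "(1/2)^n * min (dist (x (from_nat n)) (y (from_nat n))) 1 \<le> (1/2)^n * e" for n
      using assms[of "from_nat n"] by (intro mult_left_mono) (auto simp: dist_real_def min_def)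
    show "summable (\<lambda>n. (1/2)^n * min (dist (x (from_nat n)) (y (from_nat n))) 1)"
      by (rule summable_comparison_test'[of "\<lambda>n. (1/2)^n"]) (auto simp: summable_geometric_iff)
    show "summable (\<lambda>n. (1/2)^n * e)"
      by (intro summable_mult2) (auto simp: summable_geometric_iff)
  qed
  also have "\<dots> = 2 * e"
    by (subst suminf_mult2[symmetric]) (auto simp: suminf_geometric summable_geometric_iff)
  finally show ?thesis
    by (simp add: dist_fun_def)
qed

text \<open>A Lebesgue number for the cover of \<open>K\<close> by preimages of open vertex stars:
  at any point some coordinate is at least \<open>d\<close>, and by uniform continuity it moves by
  less than \<open>d\<close> on a small enough set.\<close>

lemma compact_fine_common_vertex:
  fixes K :: "'b::metric_space set" and F :: "'b \<Rightarrow> 'a \<Rightarrow> real"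
  assumes K: "compact K" and V: "finite V"
    and cont: "\<And>v. v \<in> V \<Longrightarrow> continuous_on K (\<lambda>u. F u v)"
    and sum: "\<And>u. u \<in> K \<Longrightarrow> sum (F u) V = 1"
  obtains \<delta> where "\<delta> > 0"
    "\<And>T. T \<subseteq> K \<Longrightarrow> T \<noteq> {} \<Longrightarrow> (\<And>u u'. u \<in> T \<Longrightarrow> u' \<in> T \<Longrightarrow> dist u u' < \<delta>) \<Longrightarrow>
      \<exists>v\<in>V. \<forall>u\<in>T. F u v > 0"
proof -
  \<comment> \<open>The summand 1 in the denominator makes \<open>card V * d < 1\<close>, so the
    coordinates cannot all lie below \<open>d\<close>.\<close>
  define d where "d = 1 / (1 + real (card V))"
  have d: "d > 0"
    by (simp add: d_def)
  have "\<exists>\<delta>>0. \<forall>u\<in>K. \<forall>u'\<in>K. dist u' u < \<delta> \<longrightarrow> dist (F u' v) (F u v) < d" if "v \<in> V" for v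
    using compact_uniformly_continuous[OF cont[OF that] K] d unfolding uniformly_continuous_on_def by blast
  then obtain \<delta> where \<delta>: "\<And>v. v \<in> V \<Longrightarrow> \<delta> v > 0"
    "\<And>v u u'. v \<in> V \<Longrightarrow> u \<in> K \<Longrightarrow> u' \<in> K \<Longrightarrow> dist u' u < \<delta> v \<Longrightarrow> dist (F u' v) (F u v) < d"
    by metis
  show ?thesis
  proof
    \<comment> \<open>Inserting 1 keeps the minimum meaningful when \<open>V\<close> is
      empty.\<close>
    show "Min (insert 1 (\<delta> ` V)) > 0"
      using V \<delta>(1) by auto
    fix T
    assume T: "T \<subseteq> K" "T \<noteq> {}" "\<And>u u'. u \<in> T \<Longrightarrow> u' \<in> T \<Longrightarrow> dist u u' < Min (insert 1 (\<delta> ` V))"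
    then obtain u where u: "u \<in> T"
      by blast
    have "\<exists>v\<in>V. F u v \<ge> d"
    proof (rule ccontr)
      assume "\<not> ?thesis"
      then have "sum (F u) V \<le> of_nat (card V) * d"
        by (intro sum_bounded_above) (auto simp: not_le intro: less_imp_le)
      also have "\<dots> < 1"
        by (simp add: d_def)
      finally show False
        using sum u T(1) by force
    qed
    then obtain v where v: "v \<in> V" "F u v \<ge> d"
      by blast
    have "F u' v > 0" if "u' \<in> T" for u'
    proof -
      have "dist u u' < \<delta> v"
        using T(3)[OF u that] V v(1) by simp
      then have "dist (F u v) (F u' v) < d"
        using \<delta>(2) v(1) T(1) u that by blast
      then show ?thesis
        using v(2) by (simp add: dist_real_def)
    qed
    then show "\<exists>v\<in>V. \<forall>u\<in>T. F u v > 0"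
      using v(1) by blast
  qed
qed

section \<open>The boundary of the cube as a model of the sphere\<close>

text \<open>Replaces the round sphere because each of its points has a coordinate 1 or -1. After
  scaling by a natural number that coordinate is still an integer, as the count of open stars
  requires.\<close>

definition cube_boundary :: "nat \<Rightarrow> (nat \<Rightarrow> real) set" where
  "cube_boundary n = {u. (\<forall>j>n. u j = 0) \<and> (\<forall>j\<le>n. \<bar>u j\<bar> \<le> 1) \<and> (\<exists>j\<le>n. \<bar>u j\<bar> = 1)}"

lemma compact_cube_boundary: "compact (cube_boundary n)"
proof -
  let ?B = "PiE UNIV (\<lambda>j. if j \<le> n then {-1..1::real} else {0})"
  have "compactin (product_topology (\<lambda>_. euclideanreal) UNIV) ?B"
    by (subst compactin_PiE) auto
  then have "compact ?B"
    by (simp add: euclidean_product_topology)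
  moreover have "closed (\<Union>j\<le>n. {u::nat \<Rightarrow> real. \<bar>u j\<bar> = 1})"
    by (intro closed_UN ballI closed_Collect_eq continuous_on_rabs continuous_on_const
        continuous_on_coordinate) simp
  moreover have "u \<in> ?B \<longleftrightarrow> (\<forall>j. (j \<le> n \<longrightarrow> \<bar>u j\<bar> \<le> 1) \<and> (n < j \<longrightarrow> u j = 0))" for u
    by (simp add: PiE_iff, intro all_cong1) (auto simp: abs_le_iff)
  then have "cube_boundary n = ?B \<inter> (\<Union>j\<le>n. {u. \<bar>u j\<bar> = 1})"
    by (auto simp del: PiE_iff simp: cube_boundary_def)
  ultimately show ?thesis
    by (metis compact_Int_closed)
qed

text \<open>Passes from the product topology of \<open>nsphere\<close> to the type class topology,
  where \<open>continuous_on\<close> is available.\<close>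

lemma nsphere_eq_top_of_set: "nsphere n = top_of_set (topspace (nsphere n))"
  unfolding nsphere by (simp add: euclidean_product_topology)

lemma topspace_nsphere: "topspace (nsphere n) = {x. (\<Sum>i\<le>n. (x i)\<^sup>2) = 1 \<and> (\<forall>i>n. x i = 0)}"
  by (simp add: nsphere)

definition max_norm :: "nat \<Rightarrow> (nat \<Rightarrow> real) \<Rightarrow> real" where
  "max_norm n x = Max ((\<lambda>j. \<bar>x j\<bar>) ` {..n})"

lemma continuous_on_max_norm: "continuous_on S (max_norm n)"
proof (induction n)
  case 0
  have "max_norm 0 = (\<lambda>x. \<bar>x 0\<bar>)"
    by (auto simp: max_norm_def)
  then show ?case
    by (auto intro!: continuous_intros continuous_on_coordinate)
next
  case (Suc n)
  have "max_norm (Suc n) = (\<lambda>x. max \<bar>x (Suc n)\<bar> (max_norm n x))"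
    by (auto simp: max_norm_def atMost_Suc)
  then show ?case
    using Suc by (auto intro!: continuous_intros continuous_on_coordinate)
qed

lemma max_norm_pos:
  assumes "x \<in> topspace (nsphere n)"
  shows "max_norm n x > 0"
proof -
  have "\<exists>j\<le>n. x j \<noteq> 0"
  proof (rule ccontr)
    assume "\<not> ?thesis"
    then have "(\<Sum>i\<le>n. (x i)\<^sup>2) = 0"
      by (intro sum.neutral) auto
    with assms show False
      by (simp add: topspace_nsphere)
  qed
  then obtain j where "j \<le> n" "\<bar>x j\<bar> > 0"
    by auto
  then show ?thesis
    unfolding max_norm_def by (subst Max_gr_iff) auto
qed

text \<open>Together with \<open>to_sphere\<close>, radial projection from the origin between sphere
  and cube boundary.\<close>

definition to_cube :: "nat \<Rightarrow> (nat \<Rightarrow> real) \<Rightarrow> nat \<Rightarrow> real" where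
  "to_cube n x j = x j / max_norm n x"

definition to_sphere :: "nat \<Rightarrow> (nat \<Rightarrow> real) \<Rightarrow> nat \<Rightarrow> real" where
  "to_sphere n u j = u j / sqrt (\<Sum>i\<le>n. (u i)\<^sup>2)"

lemma to_cube_in_cube_boundary:
  assumes "x \<in> topspace (nsphere n)"
  shows "to_cube n x \<in> cube_boundary n"
proof -
  have pos: "max_norm n x > 0"
    using max_norm_pos[OF assms] .
  have "\<bar>x j\<bar> \<le> max_norm n x" if "j \<le> n" for j
    unfolding max_norm_def using that by (intro Max_ge) auto
  moreover have "max_norm n x \<in> (\<lambda>j. \<bar>x j\<bar>) ` {..n}"
    unfolding max_norm_def by (intro Max_in) auto
  ultimately show ?thesis
    using pos assms by (auto simp: cube_boundary_def to_cube_def topspace_nsphere)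
qed

lemma sum_squares_cube_boundary:
  assumes "u \<in> cube_boundary n"
  shows "(\<Sum>i\<le>n. (u i)\<^sup>2) > 0"
proof -
  obtain j where "j \<le> n" "\<bar>u j\<bar> = 1"
    using assms by (auto simp: cube_boundary_def)
  then have "j \<in> {..n}" "(u j)\<^sup>2 > 0"
    by auto
  then show ?thesis
    by (intro sum_pos2) auto
qed

lemma to_sphere_in_nsphere:
  assumes "u \<in> cube_boundary n"
  shows "to_sphere n u \<in> topspace (nsphere n)"
  using sum_squares_cube_boundary[OF assms] assms
  by (auto simp: topspace_nsphere to_sphere_def cube_boundary_def power_divide simp flip: sum_divide_distrib)

lemma to_sphere_to_cube:
  assumes "x \<in> topspace (nsphere n)"
  shows "to_sphere n (to_cube n x) = x"
proof
  fix j
  have "(\<Sum>i\<le>n. (x i / max_norm n x)\<^sup>2) = 1 / (max_norm n x)\<^sup>2"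
    using assms by (simp add: topspace_nsphere power_divide flip: sum_divide_distrib)
  then show "to_sphere n (to_cube n x) j = x j"
    using max_norm_pos[OF assms] by (simp add: to_sphere_def to_cube_def real_sqrt_divide)
qed

lemma continuous_on_to_sphere: "continuous_on (cube_boundary n) (to_sphere n)"
proof (rule continuous_on_coordinatewise_then_product)
  fix j
  show "continuous_on (cube_boundary n) (\<lambda>u. to_sphere n u j)"
    unfolding to_sphere_def
    by (intro continuous_intros continuous_on_coordinate)
      (use sum_squares_cube_boundary in fastforce)
qed

section \<open>Deforming a sphere map to one with small supports\<close>

text \<open>A form of simplicial approximation: on a fine grid each lattice point \<open>z\<close>
  receives a vertex \<open>c z\<close> that is positive under the map on the whole open star of
  \<open>z\<close>. The hat functions, collected by vertex, give the new map, and few of them are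
  positive at any one point.\<close>

lemma homotopic_to_low_support:
  assumes X: "simplicial_complex X" "finite X"
    and f: "continuous_map (nsphere n) (geometric_realization X) f"
  obtains g where "homotopic_with (\<lambda>_. True) (nsphere n) (geometric_realization X) f g"
    "\<And>x. x \<in> topspace (nsphere n) \<Longrightarrow> card {v. g x v > 0} \<le> Suc n"
proof -
  let ?S = "topspace (nsphere n)"
  let ?V = "vertices X"
  let ?K = "cube_boundary n"
  note V = finite_vertices[OF X]
  define F where "F u = f (to_sphere n u)" for u
  have fS: "f x \<in> topspace (geometric_realization X)" if "x \<in> ?S" for x
    using f that by (auto simp: continuous_map_into_geometric_realization)
  note fx = fS[unfolded topspace_geometric_realization[OF X]]
  have contf: "continuous_on ?S (\<lambda>x. f x v)" for v
    using f nsphere_eq_top_of_set[of n]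
    by (metis continuous_map_iff_continuous continuous_map_into_geometric_realization)
  have "continuous_on ?K (\<lambda>u. F u v)" for v
    unfolding F_def
    by (rule continuous_on_compose2[OF contf continuous_on_to_sphere]) (auto intro: to_sphere_in_nsphere)
  moreover have "sum (F u) ?V = 1" if "u \<in> ?K" for u
    using fx[OF to_sphere_in_nsphere[OF that]] by (simp add: F_def)
  ultimately obtain \<delta> where \<delta>: "\<delta> > 0"
    "\<And>T. T \<subseteq> ?K \<Longrightarrow> T \<noteq> {} \<Longrightarrow> (\<And>u u'. u \<in> T \<Longrightarrow> u' \<in> T \<Longrightarrow> dist u u' < \<delta>) \<Longrightarrow>
      \<exists>v\<in>?V. \<forall>u\<in>T. F u v > 0"
    using compact_fine_common_vertex[OF compact_cube_boundary V, where F = F] by metis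
  \<comment> \<open>On one open star the scaled coordinates differ by at most 2, so two points
    differ by at most \<open>2 / N\<close> in each coordinate and by \<open>4 / N\<close> in the
    metric.\<close>
  obtain N :: nat where "4 / \<delta> < N"
    using reals_Archimedean2 by blast
  moreover have "0 < 4 / \<delta>"
    using \<delta>(1) by simp
  ultimately have "real N > 0"
    by linarith
  with \<open>4 / \<delta> < N\<close> \<delta>(1) have N: "N > 0" "4 / N < \<delta>"
    by (simp_all add: field_simps)
  define h where "h x z = hat n (\<lambda>j. N * to_cube n x j) z" for x z
  \<comment> \<open>Coordinates on the cube boundary lie in [-1, 1], so the floors of their
    multiples by \<open>N\<close> stay in this finite box.\<close>
  define Z where "Z = PiE {..n} (\<lambda>_. {- int N..int N})"
  have Z: "finite Z"
    by (simp add: Z_def finite_PiE)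
  have "\<exists>v. \<forall>u\<in>?K. hat n (\<lambda>j. N * u j) z > 0 \<longrightarrow> F u v > 0" for z
  proof -
    let ?T = "{u::nat \<Rightarrow> real. u \<in> ?K \<and> hat n (\<lambda>j. N * u j) z > 0}"
    have "dist u u' < \<delta>" if "u \<in> ?T" "u' \<in> ?T" for u u' :: "nat \<Rightarrow> real"
    proof -
      have "\<bar>u j - u' j\<bar> \<le> 2 / N" for j
      proof (cases "j \<le> n")
        case True
        then have "\<bar>N * u j - z j\<bar> < 1" "\<bar>N * u' j - z j\<bar> < 1"
          using that by (auto simp: hat_pos_iff)
        then have "\<bar>N * (u j - u' j)\<bar> \<le> 2"
          unfolding right_diff_distrib by linarith
        then have "\<bar>u j - u' j\<bar> * N \<le> 2"
          by (simp add: abs_mult mult.commute)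
        then show ?thesis
          using N(1) by (simp add: pos_le_divide_eq)
      next
        case False
        then show ?thesis
          using that by (auto simp: cube_boundary_def)
      qed
      then have "dist u u' \<le> 2 * (2 / N)"
        by (rule dist_fun_nat_le)
      with N show ?thesis
        by simp
    qed
    \<comment> \<open>If no point of the cube boundary lies in the star of \<open>z\<close>, any
      vertex serves.\<close>
    then show ?thesis
      using \<delta>(2)[of ?T] by blast
  qed
  then have "\<exists>c. \<forall>z. \<forall>u\<in>?K. hat n (\<lambda>j. N * u j) z > 0 \<longrightarrow> F u (c z) > 0"
    by (intro choice allI)
  then obtain c where c: "\<forall>z. \<forall>u\<in>?K. hat n (\<lambda>j. N * u j) z > 0 \<longrightarrow> F u (c z) > 0" ..
  have carrier: "f x (c z) > 0" if "x \<in> ?S" "h x z > 0" for x z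
    using c[rule_format, OF to_cube_in_cube_boundary[OF that(1)], of z] that
    by (simp add: h_def F_def to_sphere_to_cube)
  define Q where "Q x v = (\<Sum>z\<in>{z\<in>Z. c z = v}. h x z)" for x v
  have Q_nonneg: "Q x v \<ge> 0" for x v
    by (auto simp: Q_def h_def hat_nonneg intro!: sum_nonneg)
  have Q_pos: "\<exists>z\<in>Z. h x z > 0 \<and> c z = v" if "Q x v > 0" for x v
  proof (rule ccontr)
    assume "\<not> ?thesis"
    then have "Q x v \<le> 0"
      unfolding Q_def by (intro sum_nonpos) force
    with that show False
      by simp
  qed
  have Q_pos_ex: "\<exists>v. Q x v > 0" if "x \<in> ?S" for x
  proof -
    let ?z = "\<lambda>j\<in>{..n}. \<lfloor>N * to_cube n x j\<rfloor>"
    have "\<lfloor>N * to_cube n x j\<rfloor> \<in> {- int N..int N}" if "j \<le> n" for j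
    proof -
      have "\<bar>to_cube n x j\<bar> \<le> 1"
        using to_cube_in_cube_boundary[OF \<open>x \<in> ?S\<close>] that by (auto simp: cube_boundary_def)
      then have "\<bar>N * to_cube n x j\<bar> \<le> N"
        by (simp add: abs_mult mult_left_le)
      then have "- real N \<le> N * to_cube n x j" "N * to_cube n x j \<le> real N"
        by linarith+
      then show ?thesis
        by (auto simp: le_floor_iff floor_le_iff)
    qed
    then have "?z \<in> Z"
      unfolding Z_def by auto
    then have "Q x (c ?z) > 0"
      unfolding Q_def using Z hat_floor_pos
      by (intro sum_pos2[of _ ?z]) (auto simp: h_def hat_nonneg)
    then show ?thesis ..
  qed
  have cont_tc: "continuous_on ?S (\<lambda>x. to_cube n x j)" for j
    unfolding to_cube_def
    by (intro continuous_intros continuous_on_coordinate continuous_on_max_norm)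
      (use max_norm_pos in fastforce)
  have contQ: "continuous_on ?S (\<lambda>x. Q x v)" for v
    unfolding Q_def h_def hat_def
    by (intro continuous_intros continuous_on_prod cont_tc)
  \<comment> \<open>The straight line from \<open>f x\<close> to \<open>Q x\<close> stays in the
    carrier of \<open>f x\<close>, because \<open>carrier\<close> puts the support of
    \<open>Q x\<close> inside that of \<open>f x\<close>.\<close>
  define P where "P = (\<lambda>(t::real, x) v. (1 - t) * f x v + t * Q x v)"
  have supp: "f x v > 0" if "x \<in> ?S" "0 \<le> t" "t \<le> 1" "P (t, x) v > 0" for t x v
  proof (rule ccontr)
    assume "\<not> f x v > 0"
    with fx[OF that(1)] have "f x v = 0"
      by (metis order_le_less)
    with that have "Q x v > 0"
      by (auto simp: P_def zero_less_mult_iff)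
    then show False
      using Q_pos carrier that(1) \<open>f x v = 0\<close> by fastforce
  qed
  have "homotopic_with (\<lambda>_. True) (top_of_set ?S) (geometric_realization X)
    (\<lambda>x. normalized ?V (P (0, x))) (\<lambda>x. normalized ?V (P (1, x)))"
  proof (rule homotopic_normalized[OF X])
    show "continuous_on ({0..1} \<times> ?S) (\<lambda>y. P y v)" for v
      unfolding P_def case_prod_unfold
      by (intro continuous_intros continuous_on_compose2[OF contf] continuous_on_compose2[OF contQ]) auto
    show "0 \<le> P y v" if "y \<in> {0..1} \<times> ?S" for y v
      using that fx Q_nonneg by (auto simp: P_def)
    show "\<exists>\<sigma>\<in>X. \<forall>v. P y v > 0 \<longrightarrow> v \<in> \<sigma>" if "y \<in> {0..1} \<times> ?S" for y
      using that fx[of "snd y"] supp by (intro bexI[of _ "{v. f (snd y) v > 0}"]) auto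
    show "\<exists>v. P y v > 0" if y: "y \<in> {0..1} \<times> ?S" for y
    \<comment> \<open>A vertex positive for \<open>Q\<close> is positive for \<open>f\<close> as
      well, so one choice works at both ends of the segment.\<close>
    proof -
      obtain v where v: "Q (snd y) v > 0"
        using Q_pos_ex y by force
      then have "f (snd y) v > 0"
        using Q_pos carrier y by fastforce
      then have "P y v > 0"
        using v y by (cases "fst y = 0") (auto simp: P_def case_prod_unfold intro!: add_nonneg_pos)
      then show ?thesis ..
    qed
  qed
  then have "homotopic_with (\<lambda>_. True) (nsphere n) (geometric_realization X)
      (\<lambda>x. normalized ?V (P (0, x))) (\<lambda>x. normalized ?V (Q x))"
    by (simp add: P_def flip: nsphere_eq_top_of_set)
  moreover have "normalized ?V (P (0, x)) = f x" if "x \<in> ?S" for x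
    using fx[OF that] by (simp add: P_def normalized_eq_self)
  ultimately have "homotopic_with (\<lambda>_. True) (nsphere n) (geometric_realization X) f
      (\<lambda>x. normalized ?V (Q x))"
    by (elim homotopic_with_eq) auto
  moreover have "card {v. normalized ?V (Q x) v > 0} \<le> Suc n" if x: "x \<in> ?S" for x
  proof -
    let ?A = "{z\<in>Z. h x z > 0}"
    \<comment> \<open>This coordinate becomes \<open>N\<close> or \<open>-N\<close> after scaling
      and is the integral one for \<open>card_hat_pos_le\<close>.\<close>
    obtain j where "j \<le> n" "\<bar>to_cube n x j\<bar> = 1"
      using to_cube_in_cube_boundary[OF x] by (auto simp: cube_boundary_def)
    then have "finite ?A \<and> card ?A \<le> Suc n"
      unfolding h_def Z_def
      by (intro card_hat_pos_le[OF order_refl, of j]) (auto simp: abs_if split: if_splits)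
    moreover have "{v. normalized ?V (Q x) v > 0} \<subseteq> c ` ?A"
    proof
      fix v
      assume "v \<in> {v. normalized ?V (Q x) v > 0}"
      then have "Q x v > 0"
        using Q_nonneg[of x v] by (cases "Q x v = 0") (auto simp: normalized_def)
      then show "v \<in> c ` ?A"
        using Q_pos by blast
    qed
    ultimately show ?thesis
      using card_mono[of "c ` ?A" "{v. normalized ?V (Q x) v > 0}"] card_image_le[of ?A c] by auto
  qed
  ultimately show ?thesis
    using that by blast
qed


section \<open>Deforming into the ground simplex\<close>

text \<open>A union bound: otherwise the vertices of \<Delta> are covered by the at most
  \<open>m\<close> sets of non-neighbours of vertices of \<sigma>, each of size at most
  \<open>k\<close>.\<close>

lemma ground_common_neighbour:
  assumes X: "simplicial_complex X" and \<Delta>: "k_ground X k \<Delta>" "card \<Delta> > m * k"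
    and \<sigma>: "\<sigma> \<in> X" "card \<sigma> \<le> m"
  shows "\<exists>w\<in>\<Delta>. \<forall>v\<in>\<sigma>. w = v \<or> adjacent X v w"
proof (rule ccontr)
  assume "\<not> ?thesis"
  then have "\<Delta> \<subseteq> (\<Union>v\<in>\<sigma>. {w\<in>\<Delta>. w \<noteq> v \<and> \<not> adjacent X v w})"
    by auto
  moreover have fin: "finite \<Delta>" "finite \<sigma>"
    using finite_simplex[OF X] \<Delta>(1) \<sigma>(1) by (auto simp: k_ground_def)
  ultimately have "card \<Delta> \<le> card (\<Union>v\<in>\<sigma>. {w\<in>\<Delta>. w \<noteq> v \<and> \<not> adjacent X v w})"
    by (intro card_mono) auto
  also have "\<dots> \<le> (\<Sum>v\<in>\<sigma>. card {w\<in>\<Delta>. w \<noteq> v \<and> \<not> adjacent X v w})"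
    using fin by (intro card_UN_le)
  also have "\<dots> \<le> of_nat (card \<sigma>) * k"
    using \<Delta>(1) \<sigma>(1) by (intro sum_bounded_above) (auto simp: k_ground_def vertices_def)
  also have "\<dots> \<le> m * k"
    using \<sigma>(2) by simp
  finally show False
    using \<Delta>(2) by simp
qed

lemma homotopic_into_ground:
  fixes g :: "'b::topological_space \<Rightarrow> 'a \<Rightarrow> real"
  assumes flag: "flag_complex X" "finite X"
    and g: "continuous_map (top_of_set S) (geometric_realization X) g"
      "\<And>x. x \<in> S \<Longrightarrow> card {v. g x v > 0} \<le> m"
    and \<Delta>: "\<Delta> \<in> X"
      "\<And>\<sigma>. \<sigma> \<in> X \<Longrightarrow> card \<sigma> \<le> m \<Longrightarrow> \<exists>w\<in>\<Delta>. \<forall>v\<in>\<sigma>. w = v \<or> adjacent X v w"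
  obtains h where "homotopic_with (\<lambda>_. True) (top_of_set S) (geometric_realization X) g h"
    "\<And>x v. x \<in> S \<Longrightarrow> h x v > 0 \<Longrightarrow> v \<in> \<Delta>"
proof -
  let ?V = "vertices X"
  have X: "simplicial_complex X" "finite X"
    using flag by (auto simp: flag_complex_def)
  note V = finite_vertices[OF X]
  have gx: "(\<forall>v. 0 \<le> g x v) \<and> {v. g x v > 0} \<in> X \<and> sum (g x) ?V = 1" if "x \<in> S" for x
    using g(1) that unfolding topspace_geometric_realization[OF X, symmetric]
    by (auto simp: continuous_map_into_geometric_realization)
  have contg: "continuous_on S (\<lambda>x. g x v)" for v
    using g(1) by (simp add: continuous_map_into_geometric_realization)
  obtain w where w: "\<And>\<sigma>. \<sigma> \<in> X \<Longrightarrow> card \<sigma> \<le> m \<Longrightarrow> w \<sigma> \<in> \<Delta>"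
    "\<And>\<sigma> v. \<sigma> \<in> X \<Longrightarrow> card \<sigma> \<le> m \<Longrightarrow> v \<in> \<sigma> \<Longrightarrow> w \<sigma> = v \<or> adjacent X v (w \<sigma>)"
    using \<Delta>(2) by metis
  \<comment> \<open>For \<open>t > 0\<close> positivity says that every vertex outside \<sigma> has
    coordinate below \<open>t\<close>. The leading factor \<open>t\<close> switches \<psi> off at
    time 0 even when \<sigma> contains all vertices and the product is empty.\<close>
  define \<psi> where "\<psi> = (\<lambda>(t::real, x) \<sigma>. t * (\<Prod>u\<in>?V - \<sigma>. max 0 (t - g x u)))"
  define Q where "Q y v = (\<Sum>\<sigma>\<in>{\<sigma>\<in>X. card \<sigma> \<le> m \<and> w \<sigma> = v}. \<psi> y \<sigma>)" for y v
  define P where "P = (\<lambda>(t, x) v. max 0 (g x v - t) + Q (t, x) v)"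
  have \<psi>_nonneg: "\<psi> y \<sigma> \<ge> 0" if "y \<in> {0..1} \<times> S" for y \<sigma>
    using that by (auto simp: \<psi>_def intro!: mult_nonneg_nonneg prod_nonneg)
  have \<psi>_pos: "g x u < t" if "\<psi> (t, x) \<sigma> > 0" "u \<in> ?V" "u \<notin> \<sigma>" for t x \<sigma> u
  proof -
    have "(\<Prod>u\<in>?V - \<sigma>. max 0 (t - g x u)) \<noteq> 0"
      using that(1) by (auto simp: \<psi>_def)
    then have "max 0 (t - g x u) \<noteq> 0"
      using V that by (auto simp: prod_zero_iff)
    then show ?thesis
      by (auto simp: max_def split: if_splits)
  qed
  have Q_nonneg: "Q y v \<ge> 0" if "y \<in> {0..1} \<times> S" for y v
    unfolding Q_def using \<psi>_nonneg[OF that] by (intro sum_nonneg)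
  have Q_pos: "\<exists>\<sigma>\<in>X. card \<sigma> \<le> m \<and> w \<sigma> = v \<and> \<psi> y \<sigma> > 0" if "Q y v > 0" for y v
  proof (rule ccontr)
    assume "\<not> ?thesis"
    then have "Q y v \<le> 0"
      unfolding Q_def by (intro sum_nonpos) force
    with that show False
      by simp
  qed
  have homotopic: "homotopic_with (\<lambda>_. True) (top_of_set S) (geometric_realization X)
    (\<lambda>x. normalized ?V (P (0, x))) (\<lambda>x. normalized ?V (P (1, x)))"
  proof (rule homotopic_normalized[OF X])
    show "continuous_on ({0..1} \<times> S) (\<lambda>y. P y v)" for v
      unfolding P_def Q_def \<psi>_def case_prod_unfold prod.sel
      by (intro continuous_intros continuous_on_prod continuous_on_compose2[OF contg]) auto
    show "0 \<le> P y v" if "y \<in> {0..1} \<times> S" for y v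
      using that Q_nonneg by (auto simp: P_def)
    show "\<exists>v. P y v > 0" if yS: "y \<in> {0..1} \<times> S" for y
    proof -
      obtain t x where y: "y = (t, x)" "0 \<le> t" "x \<in> S"
        using yS by auto
      let ?\<sigma> = "{v. g x v > 0}"
      note gx = gx[OF \<open>x \<in> S\<close>]
      show ?thesis
      proof (cases "t = 0")
        case True
        have "?\<sigma> \<noteq> {}"
          using gx by (intro simplex_nonempty[OF X(1)]) blast
        then obtain v where "g x v > 0"
          by blast
        then have "P y v > 0"
          using True y Q_nonneg[OF yS, of v] by (auto simp: P_def intro!: add_pos_nonneg)
        then show ?thesis ..
      next
        case False
        with y have t: "t > 0"
          by simp
        \<comment> \<open>The support of \<open>g x\<close> itself is an admissible \<sigma>: it has
          at most \<open>m\<close> vertices, and all coordinates outside it are 0, hence below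
          \<open>t\<close>.\<close>
        have "max 0 (t - g x u) > 0" if "u \<notin> ?\<sigma>" for u
          using that gx t by (auto simp: not_less max_def)
        then have "\<psi> y ?\<sigma> > 0"
          using t by (auto simp: \<psi>_def y intro!: mult_pos_pos prod_pos)
        then have "Q y (w ?\<sigma>) > 0"
          unfolding Q_def using X(2) gx g(2)[OF \<open>x \<in> S\<close>] \<psi>_nonneg[OF yS]
          by (intro sum_pos2[of _ ?\<sigma>]) auto
        then have "P y (w ?\<sigma>) > 0"
          by (auto simp: P_def y intro!: add_nonneg_pos)
        then show ?thesis ..
      qed
    qed
    show "\<exists>\<sigma>\<in>X. \<forall>v. P y v > 0 \<longrightarrow> v \<in> \<sigma>" if yS: "y \<in> {0..1} \<times> S" for y
    proof -
      obtain t x where y: "y = (t, x)" "0 \<le> t" "x \<in> S"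
        using yS by auto
      note gx = gx[OF \<open>x \<in> S\<close>]
      let ?\<tau> = "{v. g x v > t}"
      let ?W = "{v. Q y v > 0}"
      have \<tau>: "?\<tau> \<subseteq> {v. g x v > 0}"
        using y by auto
      have W: "?W \<subseteq> \<Delta>"
        using Q_pos w(1) by blast
      have simplex: "{u, v} \<in> X" if "u \<in> \<sigma>" "v \<in> \<sigma>" "\<sigma> \<in> X" for u v \<sigma>
        by (rule face_in_complex[OF X(1) that(3)]) (use that in auto)
      \<comment> \<open>A vertex with coordinate above \<open>t\<close> belongs to every \<sigma>
        with positive weight, so it equals or is adjacent to each \<open>w \<sigma>\<close> that
        receives mass.\<close>
      have cross: "adjacent X u v \<and> adjacent X v u" if uv: "u \<in> ?\<tau>" "v \<in> ?W" "u \<noteq> v" for u v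
      proof -
        obtain \<sigma> where \<sigma>: "\<sigma> \<in> X" "card \<sigma> \<le> m" "w \<sigma> = v" "\<psi> y \<sigma> > 0"
          using Q_pos uv(2) by blast
        have "u \<in> ?V"
          using uv(1) gx \<tau> by (auto simp: vertices_def)
        then have "u \<in> \<sigma>"
          using \<psi>_pos[of t x \<sigma> u] \<sigma>(4) uv(1) by (auto simp: y)
        then show ?thesis
          using w(2)[OF \<sigma>(1,2)] \<sigma>(3) uv(3) by (auto simp: adjacent_def insert_commute)
      qed
      have sub: "?\<tau> \<union> ?W \<subseteq> ?V"
        using \<tau> W gx \<Delta>(1) by (auto simp: vertices_def)
      have "adjacent X u v" if uv: "u \<in> ?\<tau> \<union> ?W" "v \<in> ?\<tau> \<union> ?W" and "u \<noteq> v" for u v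
      proof -
        consider "u \<in> ?\<tau>" "v \<in> ?\<tau>" | "u \<in> ?W" "v \<in> ?W" | "u \<in> ?\<tau>" "v \<in> ?W" | "u \<in> ?W" "v \<in> ?\<tau>"
          using uv by blast
        then show ?thesis
        proof cases
          case 1
          then show ?thesis
            using \<tau> gx \<open>u \<noteq> v\<close> simplex[of u "{v. g x v > 0}" v] by (auto simp: adjacent_def)
        next
          case 2
          then show ?thesis
            using W \<Delta>(1) \<open>u \<noteq> v\<close> simplex[of u \<Delta> v] by (auto simp: adjacent_def)
        qed (use cross \<open>u \<noteq> v\<close> in blast)+
      qed
      moreover have "finite (?\<tau> \<union> ?W)"
        using sub V finite_subset by blast
      moreover have in_union: "v \<in> ?\<tau> \<union> ?W" if "P y v > 0" for v
        using that by (auto simp: P_def y max_def split: if_splits)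
      ultimately have "?\<tau> \<union> ?W \<in> X" if "?\<tau> \<union> ?W \<noteq> {}"
        using flag(1) sub that unfolding flag_complex_def by blast
      \<comment> \<open>Flagness makes the union a simplex once it is nonempty; in the empty case
        \<Delta> is a vacuous witness.\<close>
      then show ?thesis
        using in_union \<Delta>(1) by (cases "?\<tau> \<union> ?W = {}") blast+
    qed
  qed
  have "normalized ?V (P (0, x)) = g x" if "x \<in> S" for x
  proof -
    have "P (0, x) = g x"
      using gx[OF that] by (auto simp: P_def Q_def \<psi>_def)
    then show ?thesis
      using gx[OF that] by (simp add: normalized_eq_self)
  qed
  with homotopic have "homotopic_with (\<lambda>_. True) (top_of_set S) (geometric_realization X)
      g (\<lambda>x. normalized ?V (P (1, x)))"
    by (elim homotopic_with_eq) auto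
  moreover have "v \<in> \<Delta>" if "x \<in> S" "normalized ?V (P (1, x)) v > 0" for x v
  proof -
    note gx = gx[OF that(1)]
    have y: "(1::real, x) \<in> {0..1} \<times> S"
      using that(1) by simp
    \<comment> \<open>With all coordinates at most 1, the part cut down from \<open>g\<close> is
      gone at time 1 and only mass on \<Delta> is left.\<close>
    have le1: "g x v \<le> 1"
    proof (cases "g x v > 0")
      case True
      then have "v \<in> ?V"
        using gx by (auto simp: vertices_def)
      then have "g x v \<le> sum (g x) ?V"
        using V gx by (intro member_le_sum) auto
      with gx show ?thesis
        by simp
    qed simp
    have nonneg: "P (1, x) u \<ge> 0" for u
      using Q_nonneg[OF y] by (auto simp: P_def)
    have "P (1, x) v > 0"
      using that(2) nonneg[of v] sum_nonneg[of ?V "P (1, x)"] nonneg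
      by (auto simp: normalized_def zero_less_divide_iff)
    then have "Q (1, x) v > 0"
      using le1 by (simp add: P_def)
    then show ?thesis
      using Q_pos w(1) by blast
  qed
  ultimately show ?thesis
    using that by blast
qed

section \<open>Contraction inside one simplex and the connectivity bound\<close>

text \<open>A simplex is convex: the straight line to one of its vertices never leaves it.\<close>

lemma homotopic_const_in_simplex:
  fixes h :: "'b::topological_space \<Rightarrow> 'a \<Rightarrow> real"
  assumes X: "simplicial_complex X" "finite X"
    and h: "continuous_map (top_of_set S) (geometric_realization X) h"
    and \<Delta>: "\<Delta> \<in> X" "\<And>x v. x \<in> S \<Longrightarrow> h x v > 0 \<Longrightarrow> v \<in> \<Delta>"
  shows "\<exists>c. homotopic_with (\<lambda>_. True) (top_of_set S) (geometric_realization X) h (\<lambda>_. c)"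
proof -
  let ?V = "vertices X"
  have hx: "(\<forall>v. 0 \<le> h x v) \<and> {v. h x v > 0} \<in> X \<and> sum (h x) ?V = 1" if "x \<in> S" for x
    using h that unfolding topspace_geometric_realization[OF X, symmetric]
    by (auto simp: continuous_map_into_geometric_realization)
  have conth: "continuous_on S (\<lambda>x. h x v)" for v
    using h by (simp add: continuous_map_into_geometric_realization)
  obtain w where w: "w \<in> \<Delta>"
    using \<Delta>(1) simplex_nonempty[OF X(1)] by blast
  define P where "P = (\<lambda>(t::real, x) v. (1 - t) * h x v + t * (if v = w then 1 else 0))"
  have "homotopic_with (\<lambda>_. True) (top_of_set S) (geometric_realization X)
    (\<lambda>x. normalized ?V (P (0, x))) (\<lambda>x. normalized ?V (P (1, x)))"
  proof (rule homotopic_normalized[OF X])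
    show "continuous_on ({0..1} \<times> S) (\<lambda>y. P y v)" for v
      unfolding P_def case_prod_unfold prod.sel
      by (intro continuous_intros continuous_on_compose2[OF conth]) auto
    show "0 \<le> P y v" if "y \<in> {0..1} \<times> S" for y v
      using that hx by (auto simp: P_def)
    show "\<exists>\<sigma>\<in>X. \<forall>v. P y v > 0 \<longrightarrow> v \<in> \<sigma>" if "y \<in> {0..1} \<times> S" for y
    proof (intro bexI[of _ \<Delta>] allI impI)
      fix v
      assume "P y v > 0"
      then show "v \<in> \<Delta>"
        using that w \<Delta>(2)[of "snd y" v] by (auto simp: P_def zero_less_mult_iff split: if_splits)
    qed (rule \<Delta>(1))
    show "\<exists>v. P y v > 0" if y: "y \<in> {0..1} \<times> S" for y
    proof (cases "fst y = 0")
      case True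
      have "{v. h (snd y) v > 0} \<noteq> {}"
        using hx[of "snd y"] y by (intro simplex_nonempty[OF X(1)]) auto
      then show ?thesis
        using True by (auto simp: P_def case_prod_unfold)
    next
      case False
      then have "P y w > 0"
        using y hx by (auto simp: P_def intro!: add_nonneg_pos)
      then show ?thesis ..
    qed
  qed
  moreover have "normalized ?V (P (0, x)) = h x" if "x \<in> S" for x
    using hx[OF that] by (simp add: P_def normalized_eq_self)
  ultimately have "homotopic_with (\<lambda>_. True) (top_of_set S) (geometric_realization X)
      h (\<lambda>x. normalized ?V (\<lambda>v. if v = w then 1 else 0))"
    by (elim homotopic_with_eq) (auto simp: P_def)
  then show ?thesis
    by blast
qed

theorem theorem4p9:
  fixes X :: "'a set set" and m k :: nat
  assumes "m \<ge> 1" and "k \<ge> 1"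
    and "finite X" and "flag_complex X"
    and "grounded X (m * k) k"
  shows "n_connected (geometric_realization X) (m - 1)"
proof -
  have X: "simplicial_complex X" "finite X"
    using assms by (auto simp: flag_complex_def)
  \<comment> \<open>An \<open>n\<close>-simplex has \<open>n + 1\<close> vertices, which gives the
    strict inequality that the union bound needs.\<close>
  obtain \<Delta> where \<Delta>: "k_ground X k \<Delta>" "card \<Delta> > m * k"
    using assms(5) by (auto simp: grounded_def)
  then have \<Delta>X: "\<Delta> \<in> X"
    by (simp add: k_ground_def)
  then obtain v where "v \<in> \<Delta>"
    using simplex_nonempty[OF X(1)] by blast
  then have "normalized (vertices X) (\<lambda>u. if u = v then 1 else 0) \<in> topspace (geometric_realization X)"
    using \<Delta>X by (intro normalized_in_realization(2)[OF X, of _ \<Delta> v]) (auto split: if_splits)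
  then have "topspace (geometric_realization X) \<noteq> {}"
    by blast
  moreover have "\<exists>c. homotopic_with (\<lambda>_. True) (nsphere i) (geometric_realization X) f (\<lambda>_. c)"
    if i: "i \<le> m - 1" and f: "continuous_map (nsphere i) (geometric_realization X) f" for i f
  proof -
    let ?S = "topspace (nsphere i)"
    obtain g where g: "homotopic_with (\<lambda>_. True) (nsphere i) (geometric_realization X) f g"
      "\<And>x. x \<in> ?S \<Longrightarrow> card {v. g x v > 0} \<le> Suc i"
      using homotopic_to_low_support[OF X f] by blast
    have "continuous_map (top_of_set ?S) (geometric_realization X) g"
      using homotopic_with_imp_continuous_maps[OF g(1)] by (simp flip: nsphere_eq_top_of_set)
    \<comment> \<open>As \<open>m\<close> is at least 1, the subtraction in \<open>m - 1\<close>
      does not truncate, so \<open>Suc i \<le> m\<close>.\<close>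
    moreover have "card {v. g x v > 0} \<le> m" if "x \<in> ?S" for x
      using g(2)[OF that] i assms(1) by linarith
    ultimately obtain h where
      h: "homotopic_with (\<lambda>_. True) (top_of_set ?S) (geometric_realization X) g h"
        "\<And>x v. x \<in> ?S \<Longrightarrow> h x v > 0 \<Longrightarrow> v \<in> \<Delta>"
      using homotopic_into_ground[OF assms(4,3) _ _ \<Delta>X] ground_common_neighbour[OF X(1) \<Delta>] by metis
    obtain c where "homotopic_with (\<lambda>_. True) (top_of_set ?S) (geometric_realization X) h (\<lambda>_. c)"
      using homotopic_const_in_simplex[OF X _ \<Delta>X, of ?S h] h homotopic_with_imp_continuous_maps by blast
    then show ?thesis
      using g(1) h(1) homotopic_with_trans by (metis nsphere_eq_top_of_set)
  qed
  ultimately show ?thesis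
    by (auto simp: n_connected_def)
qed

end
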